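(* Definable functions in $\mathrm{FO}(\mathbb{Z},+,\leq)$ are exactly the $\mathrm{FO}(\mathbb{Z},+,\leq)$-piecewise linear functions. That is, a partially defined function $f:\mathbb{R}^n\to\mathbb{R}^q$ is definable in $\mathrm{FO}(\mathbb{Z},+,\leq)$ if and only if $f$ is $\mathrm{FO}(\mathbb{Z},+,\leq)$-piecewise linear.
   Context: Functions are partial: $f:X\to Y$ is defined on a set $\mathrm{dom}(f)\subseteq X$, and its graph is $G_f=\{(x,y)\in X\times Y\mid x\in\mathrm{dom}(f),\ y=f(x)\}$. The restriction of $f$ to $D\subseteq\mathrm{dom}(f)$ is denoted $f|_D$. $\mathrm{FO}(\mathbb{Z},+,\leq)$ is the first-order logic of the integers with addition and order (Presburger arithmetic). A set is definable in $\mathrm{FO}(\mathbb{Z},+,\leq)$ if it is the set of integer tuples satisfying some formula of this logic; in particular a definable set is a subset of some $\mathbb{Z}^m$. A partial function $f:\mathbb{R}^n\to\mathbb{R}^q$ is definable in $\mathrm{FO}(\mathbb{Z},+,\leq)$ if there is a formula $\psi(x,y)$ of this logic encoding its graph $G_f$. A partial function $f:\mathbb{R}^n\to\mathbb{R}^q$ is linear (short for $\mathbb{Q}$-linear; "affine" in other terminology) if there exist a matrix $M\in\mathbb{Q}^{q\times n}$ and a vector $v\in\mathbb{Q}^q$ such that $f(a)=Ma+v$ for all $a\in\mathrm{dom}(f)$. A partial function $f:\mathbb{R}^n\to\mathbb{R}^q$ is $\mathrm{FO}(\mathbb{Z},+,\leq)$-piecewise linear if there is a finite partition $\Pi$ of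 $\mathrm{dom}(f)$ such that every $X\in\Pi$ is definable in $\mathrm{FO}(\mathbb{Z},+,\leq)$ and $f|_X$ is linear for every $X\in\Pi$.
   Formalization: As stated, the "if" direction fails: f with domain {1} and f(1)=1/2 is piecewise linear, but its graph is not a set of integer tuples. The formal theorem says f is definable if and only if f is piecewise linear and all its values are integer points. *)

theory Defs
  imports Complex_Main "HOL-Library.Disjoint_Sets" "Jordan_Normal_Form.Matrix"
begin

datatype pa_term = Var nat | Add pa_term pa_term

datatype pa_formula =
    Le pa_term pa_term
  | Eq pa_term pa_term
  | Neg pa_formula
  | Conj pa_formula pa_formula
  | Disj pa_formula pa_formula
  | Exists nat pa_formula
  | Forall nat pa_formula

primrec term_val :: "(nat \<Rightarrow> int) \<Rightarrow> pa_term \<Rightarrow> int" where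
  "term_val e (Var i) = e i"
| "term_val e (Add s t) = term_val e s + term_val e t"

primrec sat :: "(nat \<Rightarrow> int) \<Rightarrow> pa_formula \<Rightarrow> bool" where
  "sat e (Le s t) \<longleftrightarrow> term_val e s \<le> term_val e t"
| "sat e (Eq s t) \<longleftrightarrow> term_val e s = term_val e t"
| "sat e (Neg \<phi>) \<longleftrightarrow> \<not> sat e \<phi>"
| "sat e (Conj \<phi> \<psi>) \<longleftrightarrow> sat e \<phi> \<and> sat e \<psi>"
| "sat e (Disj \<phi> \<psi>) \<longleftrightarrow> sat e \<phi> \<or> sat e \<psi>"
| "sat e (Exists i \<phi>) \<longleftrightarrow> (\<exists>z. sat (e(i := z)) \<phi>)"
| "sat e (Forall i \<phi>) \<longleftrightarrow> (\<forall>z. sat (e(i := z)) \<phi>)"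

primrec term_vars :: "pa_term \<Rightarrow> nat set" where
  "term_vars (Var i) = {i}"
| "term_vars (Add s t) = term_vars s \<union> term_vars t"

primrec free_vars :: "pa_formula \<Rightarrow> nat set" where
  "free_vars (Le s t) = term_vars s \<union> term_vars t"
| "free_vars (Eq s t) = term_vars s \<union> term_vars t"
| "free_vars (Neg \<phi>) = free_vars \<phi>"
| "free_vars (Conj \<phi> \<psi>) = free_vars \<phi> \<union> free_vars \<psi>"
| "free_vars (Disj \<phi> \<psi>) = free_vars \<phi> \<union> free_vars \<psi>"
| "free_vars (Exists i \<phi>) = free_vars \<phi> - {i}"
| "free_vars (Forall i \<phi>) = free_vars \<phi> - {i}"

text \<open>A formula with free variables among \<open>0, \<dots>, m - 1\<close> defines a set of integer points of
  \<open>carrier_vec m\<close>, the space of real \<open>m\<close>-vectors; variable \<open>i\<close> stands for the coordinate \<open>i\<close>.\<close>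

definition definable_set :: "nat \<Rightarrow> real vec set \<Rightarrow> bool" where
  "definable_set m X \<longleftrightarrow>
     (\<exists>\<phi>. free_vars \<phi> \<subseteq> {..<m} \<and> X = {vec m (\<lambda>i. of_int (e i)) | e. sat e \<phi>})"

text \<open>A partial function from real \<open>n\<close>-vectors to real \<open>q\<close>-vectors is a map \<open>f\<close> with
  \<open>dom f \<subseteq> carrier_vec n\<close> and \<open>ran f \<subseteq> carrier_vec q\<close>; a pair of its graph is identified with a
  vector of length \<open>n + q\<close> by concatenation.\<close>

definition definable_fun :: "nat \<Rightarrow> nat \<Rightarrow> (real vec \<rightharpoonup> real vec) \<Rightarrow> bool" where
  "definable_fun n q f \<longleftrightarrow> definable_set (n + q) {x @\<^sub>v y | x y. (x, y) \<in> Map.graph f}"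

definition rat_linear :: "nat \<Rightarrow> nat \<Rightarrow> (real vec \<rightharpoonup> real vec) \<Rightarrow> bool" where
  "rat_linear n q f \<longleftrightarrow>
     (\<exists>(M :: rat mat) \<in> carrier_mat q n. \<exists>(v :: rat vec) \<in> carrier_vec q.
        \<forall>a \<in> dom f. f a = Some (map_mat of_rat M *\<^sub>v a + map_vec of_rat v))"

definition piecewise_linear :: "nat \<Rightarrow> nat \<Rightarrow> (real vec \<rightharpoonup> real vec) \<Rightarrow> bool" where
  "piecewise_linear n q f \<longleftrightarrow>
     (\<exists>\<P>. finite \<P> \<and> partition_on (dom f) \<P> \<and>
        (\<forall>X \<in> \<P>. definable_set n X \<and> rat_linear n q (f |` X)))"

text \<open>A definable function takes values in the integer points, since its graph consists of integer
  points.  A piecewise linear one need not: the map \<open>x \<mapsto> x / 2\<close> with domain \<open>{1}\<close> is piecewise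
  linear, but the only point \<open>(1, 1/2)\<close> of its graph is not an integer point.  Hence integrality of
  the values has to be required separately to characterise definability.\<close>

definition int_points :: "nat \<Rightarrow> real vec set" where
  "int_points m = {v \<in> carrier_vec m. \<forall>i < m. v $ i \<in> \<int>}"

end

theory Submission
  imports Defs
begin

text \<open>Presburger definable predicates admit quantifier elimination down to linear inequalities and
  divisibilities.  Along one variable \<open>x\<close>, a quantifier-free predicate is \<open>D\<close>-periodic except at
  finitely many solutions of equations \<open>k * x + l = 0\<close> with \<open>k \<noteq> 0\<close> and \<open>l\<close> an affine form in the
  other variables.  This gives the elimination step.  It also shows that a definable function is
  piecewise linear: a coordinate of the value is uniquely determined by the argument, so shifting
  it by \<open>D\<close> breaks membership in the graph, hence it solves one of these finitely many equations.\<close>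

section \<open>Affine forms and quantifier-free predicates\<close>

text \<open>Predicates and affine forms are functions on environments rather than syntax, so closure
  under substitution and Boolean operations needs no manipulation of formulas; syntax returns only
  where a formula has to be exhibited. The equations come from the inequalities: shifting
  \<open>x\<close> by \<open>D\<close> changes the truth of an inequality only if its form takes one
  of finitely many values around 0, whereas a divisibility does not notice a shift by a multiple of
  its divisor. Shifts go downwards, so a witness that meets no breakpoint can be pushed arbitrarily
  far down, where every inequality has become constant; this is elimination in the style of Cooper,
  with equations as the exceptional points. Two obstacles remain. A coordinate may solve several
  equations at one argument, so the sets on which a given choice of equations holds overlap and have
  to be refined to a partition. For the converse, the language has neither constants nor rational
  coefficients, so denominators are cleared, and 0 and 1 are themselves defined by formulas.\<close>

inductive affine_form :: "((nat \<Rightarrow> int) \<Rightarrow> int) \<Rightarrow> bool" where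
  const: "affine_form (\<lambda>e. c)"
| var: "affine_form (\<lambda>e. e i)"
| add: "affine_form l \<Longrightarrow> affine_form l' \<Longrightarrow> affine_form (\<lambda>e. l e + l' e)"
| scale: "affine_form l \<Longrightarrow> affine_form (\<lambda>e. c * l e)"

lemma affine_form_diff:
  assumes "affine_form l" "affine_form l'"
  shows "affine_form (\<lambda>e. l e - l' e)"
  using add[OF assms(1) scale[OF assms(2), of "-1"]] by simp

lemma affine_form_sum:
  assumes "\<And>i. i \<in> I \<Longrightarrow> affine_form (l i)"
  shows "affine_form (\<lambda>e. \<Sum>i\<in>I. l i e)"
  using assms by (induction I rule: infinite_finite_induct) (auto intro: affine_form.intros)

lemma affine_form_term_val: "affine_form (\<lambda>e. term_val e t)"
  by (induction t) (auto intro: affine_form.intros)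

lemma affine_form_subst: "affine_form l \<Longrightarrow> affine_form (\<lambda>e. l (e(i := c)))"
proof (induction rule: affine_form.induct)
  case (var j)
  show ?case by (cases "j = i") (auto intro: affine_form.intros)
qed (auto intro: affine_form.intros)

text \<open>A semantic substitute for "variable \<open>i\<close> does not occur", needed because
  forms and predicates carry no syntax.\<close>

definition indep :: "nat \<Rightarrow> ((nat \<Rightarrow> int) \<Rightarrow> 'a) \<Rightarrow> bool" where
  "indep i h \<longleftrightarrow> (\<forall>e z. h (e(i := z)) = h e)"

lemma indepD: "indep i h \<Longrightarrow> h (e(i := z)) = h e"
  by (simp add: indep_def)

lemma affine_form_split:
  assumes "affine_form l"
  obtains k l' where "affine_form l'" "indep i l'" "\<And>e. l e = k * e i + l' e"
proof -
  from assms have "\<exists>k l'. affine_form l' \<and> indep i l' \<and> (\<forall>e. l e = k * e i + l' e)"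
  proof (induction rule: affine_form.induct)
    case (const c)
    show ?case
      by (rule exI[of _ 0], rule exI[of _ "\<lambda>e. c"]) (auto intro: affine_form.intros simp: indep_def)
  next
    case (var j)
    show ?case
    proof (cases "j = i")
      case True
      then show ?thesis
        by (intro exI[of _ 1] exI[of _ "\<lambda>e. 0"]) (auto intro: affine_form.intros simp: indep_def)
    next
      case False
      then show ?thesis
        by (intro exI[of _ 0] exI[of _ "\<lambda>e. e j"]) (auto intro: affine_form.intros simp: indep_def)
    qed
  next
    case (add l1 l2)
    then obtain k1 l1' k2 l2' where
      "affine_form l1'" "indep i l1'" "\<forall>e. l1 e = k1 * e i + l1' e"
      "affine_form l2'" "indep i l2'" "\<forall>e. l2 e = k2 * e i + l2' e" by blast
    then show ?case
      by (intro exI[of _ "k1 + k2"] exI[of _ "\<lambda>e. l1' e + l2' e"])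
        (auto intro: affine_form.intros simp: indep_def algebra_simps)
  next
    case (scale l1 c)
    then obtain k1 l1' where
      "affine_form l1'" "indep i l1'" "\<forall>e. l1 e = k1 * e i + l1' e" by blast
    then show ?case
      by (intro exI[of _ "c * k1"] exI[of _ "\<lambda>e. c * l1' e"])
        (auto intro: affine_form.intros simp: indep_def algebra_simps)
  qed
  then show thesis using that by blast
qed

text \<open>An affine form may mention any variables. If a vector of length \<open>n\<close> is
  represented by an environment that vanishes from \<open>n\<close> on, all other variables drop
  out, and the form becomes a row of coefficients for the entries of the vector.\<close>

lemma affine_form_explicit:
  assumes "affine_form l"
  shows "\<exists>c a. \<forall>e. (\<forall>j\<ge>n. e j = 0) \<longrightarrow> l e = c + (\<Sum>j<n. a j * e j)"
  using assms
proof (induction rule: affine_form.induct)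
  case (const c)
  show ?case by (intro exI[of _ c] exI[of _ "\<lambda>j. 0"]) simp
next
  case (var i)
  have "(\<Sum>j<n. (if j = i then 1 else 0) * e j) = (if i < n then e i else 0)" for e :: "nat \<Rightarrow> int"
  proof -
    have "(\<Sum>j<n. (if j = i then 1 else 0) * e j) = (\<Sum>j<n. if j = i then e j else 0)"
      by (intro sum.cong) auto
    then show ?thesis by simp
  qed
  then show ?case
    by (intro exI[of _ 0] exI[of _ "\<lambda>j. if j = i then 1 else 0"]) (simp add: not_less)
next
  case (add l1 l2)
  then obtain c1 a1 c2 a2 where
    "\<forall>e. (\<forall>j\<ge>n. e j = 0) \<longrightarrow> l1 e = c1 + (\<Sum>j<n. a1 j * e j)"
    "\<forall>e. (\<forall>j\<ge>n. e j = 0) \<longrightarrow> l2 e = c2 + (\<Sum>j<n. a2 j * e j)" by blast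
  then show ?case
    by (intro exI[of _ "c1 + c2"] exI[of _ "\<lambda>j. a1 j + a2 j"])
      (simp add: algebra_simps sum.distrib)
next
  case (scale l1 c)
  then obtain c1 a1 where
    "\<forall>e. (\<forall>j\<ge>n. e j = 0) \<longrightarrow> l1 e = c1 + (\<Sum>j<n. a1 j * e j)" by blast
  then show ?case
    by (intro exI[of _ "c * c1"] exI[of _ "\<lambda>j. c * a1 j"])
      (simp add: algebra_simps sum_distrib_left)
qed

text \<open>The condition \<open>d \<noteq> 0\<close> makes \<open>\<bar>d\<bar>\<close> available
  as a positive period. Divisibility by 0 would be an equation, which is not periodic; equations are
  obtained as conjunctions of two inequalities instead.\<close>

inductive quant_free :: "((nat \<Rightarrow> int) \<Rightarrow> bool) \<Rightarrow> bool" where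
  le: "affine_form l \<Longrightarrow> quant_free (\<lambda>e. l e \<le> 0)"
| dvd: "affine_form l \<Longrightarrow> d \<noteq> 0 \<Longrightarrow> quant_free (\<lambda>e. d dvd l e)"
| neg: "quant_free P \<Longrightarrow> quant_free (\<lambda>e. \<not> P e)"
| conj: "quant_free P \<Longrightarrow> quant_free Q \<Longrightarrow> quant_free (\<lambda>e. P e \<and> Q e)"

lemma quant_free_disj:
  assumes "quant_free P" "quant_free Q"
  shows "quant_free (\<lambda>e. P e \<or> Q e)"
  using neg[OF conj[OF neg[OF assms(1)] neg[OF assms(2)]]] by simp

lemma quant_free_const: "quant_free (\<lambda>e. b)"
  using le[OF const, of "if b then 0 else 1"] by (cases b) auto

lemma quant_free_bex:
  assumes "finite A" "\<And>a. a \<in> A \<Longrightarrow> quant_free (P a)"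
  shows "quant_free (\<lambda>e. \<exists>a\<in>A. P a e)"
  using assms by (induction A) (auto intro: quant_free_const quant_free_disj)

lemma quant_free_subst: "quant_free P \<Longrightarrow> quant_free (\<lambda>e. P (e(i := c)))"
  by (induction rule: quant_free.induct)
    (auto intro: quant_free.intros affine_form_subst simp del: fun_upd_apply)

section \<open>Quantifier elimination\<close>

text \<open>Scaling an atom by \<open>k * k > 0\<close> allows to replace \<open>k * e i\<close> by \<open>- l e\<close> in it, whatever the
  sign of \<open>k\<close>.\<close>

lemma quant_free_solve:
  assumes "quant_free P" and k: "k \<noteq> 0" and l: "affine_form l" "indep i l"
  shows "\<exists>Q. quant_free Q \<and> indep i Q \<and> (\<forall>e. k * e i + l e = 0 \<longrightarrow> P e = Q e)"
  using assms(1)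
proof (induction rule: quant_free.induct)
  have atom: "\<exists>h. affine_form h \<and> indep i h \<and> (\<forall>e. k * e i + l e = 0 \<longrightarrow> k * k * l1 e = h e)"
    if l1: "affine_form l1" for l1
  proof -
    obtain k1 l1' where l1': "affine_form l1'" "indep i l1'" "\<And>e. l1 e = k1 * e i + l1' e"
      using affine_form_split[OF l1] by metis
    have "k * k * l1 e = k * k * l1' e - k * k1 * l e" if "k * e i + l e = 0" for e
    proof -
      have "l e = - (k * e i)" using that by simp
      then show ?thesis by (simp add: l1'(3) algebra_simps)
    qed
    moreover have "affine_form (\<lambda>e. k * k * l1' e - k * k1 * l e)"
      using l1'(1) l(1) by (intro affine_form_diff scale)
    moreover have "indep i (\<lambda>e. k * k * l1' e - k * k1 * l e)"
      using l1'(2) l(2) by (simp add: indep_def)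
    ultimately show ?thesis by blast
  qed
  {
    case (le l1)
    then obtain h where h: "affine_form h" "indep i h"
      "\<forall>e. k * e i + l e = 0 \<longrightarrow> k * k * l1 e = h e" using atom by blast
    have "0 < k * k" using k by (simp add: zero_less_mult_iff) linarith
    then have "l1 e \<le> 0 \<longleftrightarrow> k * k * l1 e \<le> 0" for e
      by (metis mult_le_cancel_left_pos mult_zero_right)
    with h show ?case
      by (intro exI[of _ "\<lambda>e. h e \<le> 0"]) (auto intro: quant_free.intros simp: indep_def)
  next
    case (dvd l1 d)
    then obtain h where h: "affine_form h" "indep i h"
      "\<forall>e. k * e i + l e = 0 \<longrightarrow> k * k * l1 e = h e" using atom by blast
    \<comment> \<open>The divisor is scaled together with the form, so the scaled divisibility is
      equivalent to the original one.\<close>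
    have "d dvd l1 e \<longleftrightarrow> k * k * d dvd h e" if "k * e i + l e = 0" for e
    proof -
      have "h e = k * k * l1 e" using h(3) that by simp
      then show ?thesis using k by simp
    qed
    moreover have "quant_free (\<lambda>e. k * k * d dvd h e)"
      using h(1) k dvd(2) by (intro quant_free.intros) auto
    ultimately show ?case
      using h(2) by (intro exI[of _ "\<lambda>e. k * k * d dvd h e"]) (simp add: indep_def)
  next
    case (neg P)
    then obtain Q where "quant_free Q" "indep i Q" "\<forall>e. k * e i + l e = 0 \<longrightarrow> P e = Q e" by blast
    then show ?case
      by (intro exI[of _ "\<lambda>e. \<not> Q e"]) (auto intro: quant_free.intros simp: indep_def)
  next
    case (conj P P')
    then obtain Q Q' where "quant_free Q" "indep i Q" "\<forall>e. k * e i + l e = 0 \<longrightarrow> P e = Q e"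
      "quant_free Q'" "indep i Q'" "\<forall>e. k * e i + l e = 0 \<longrightarrow> P' e = Q' e" by blast
    then show ?case
      by (intro exI[of _ "\<lambda>e. Q e \<and> Q' e"]) (auto intro: quant_free.intros simp: indep_def)
  }
qed

section \<open>Breakpoints and the limit at minus infinity\<close>

definition breakpoints :: "nat \<Rightarrow> (int \<times> ((nat \<Rightarrow> int) \<Rightarrow> int)) set \<Rightarrow> bool" where
  "breakpoints i A \<longleftrightarrow> finite A \<and> (\<forall>(k, l)\<in>A. k \<noteq> 0 \<and> affine_form l \<and> indep i l)"

text \<open>The breakpoints depend on the shift \<open>D\<close>, and the two sides of a conjunction
  come with different periods. Allowing every positive multiple \<open>D\<close> of
  \<open>D0\<close> lets both sides use one common shift, after which the union of their breakpoints
  works.\<close>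

lemma quant_free_breakpoints:
  assumes "quant_free P"
  shows "\<exists>D0>0. \<forall>D>0. D0 dvd D \<longrightarrow> (\<exists>A. breakpoints i A \<and>
    (\<forall>e. (\<forall>(k, l)\<in>A. k * e i + l e \<noteq> 0) \<longrightarrow> P e = P (e(i := e i - D))))"
  using assms
proof (induction rule: quant_free.induct)
  case (le l)
  obtain k l' where l': "affine_form l'" "indep i l'" "\<And>e. l e = k * e i + l' e"
    using affine_form_split[OF le] by metis
  have "\<exists>A. breakpoints i A \<and>
      (\<forall>e. (\<forall>(k, l)\<in>A. k * e i + l e \<noteq> 0) \<longrightarrow> (l e \<le> 0) = (l (e(i := e i - D)) \<le> 0))"
    if "D > 0" for D
  proof (cases "k = 0")
    case True
    then show ?thesis
      using l' by (intro exI[of _ "{}"])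
        (simp add: breakpoints_def indepD[OF l'(2)] del: fun_upd_apply)
  next
    case False
    \<comment> \<open>The shift changes \<open>l\<close> by \<open>k * D\<close>, so the truth of
      \<open>l e \<le> 0\<close> can flip only when \<open>l e\<close> is at most
      \<open>\<bar>k * D\<bar>\<close> in absolute value. Each value \<open>j\<close> in this window
      contributes the equation \<open>l e = j\<close>.\<close>
    define A where "A = (\<lambda>j. (k, \<lambda>e. l' e - j)) ` {- \<bar>k * D\<bar>..\<bar>k * D\<bar>}"
    have "breakpoints i A"
      using l' False
      by (auto simp: A_def breakpoints_def indep_def intro!: affine_form_diff const)
    moreover have "(l e \<le> 0) = (l (e(i := e i - D)) \<le> 0)"
      if *: "\<forall>(k, l)\<in>A. k * e i + l e \<noteq> 0" for e
    proof (rule ccontr)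
      have shift: "l (e(i := e i - D)) = l e - k * D"
        by (simp add: l'(3) indepD[OF l'(2)] algebra_simps)
      assume "(l e \<le> 0) \<noteq> (l (e(i := e i - D)) \<le> 0)"
      then have "l e \<in> {- \<bar>k * D\<bar>..\<bar>k * D\<bar>}" unfolding shift by auto
      then have "(k, \<lambda>e'. l' e' - l e) \<in> A" by (auto simp: A_def)
      from bspec[OF * this] show False by (simp add: l'(3))
    qed
    ultimately show ?thesis by blast
  qed
  then show ?case by (intro exI[of _ 1]) (simp del: fun_upd_apply)
next
  case (dvd l d)
  obtain k l' where l': "affine_form l'" "indep i l'" "\<And>e. l e = k * e i + l' e"
    using affine_form_split[OF dvd(1)] by metis
  have "d dvd l e \<longleftrightarrow> d dvd l (e(i := e i - D))" if "d dvd D" for D e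
  proof -
    have "l (e(i := e i - D)) = l e - k * D" by (simp add: l'(3) indepD[OF l'(2)] algebra_simps)
    moreover have "d dvd k * D" using that by simp
    ultimately show ?thesis by (metis diff_add_cancel dvd_add_left_iff)
  qed
  moreover have "breakpoints i {}" by (simp add: breakpoints_def)
  ultimately show ?case
    using dvd(2) by (intro exI[of _ "\<bar>d\<bar>"]) (metis abs_dvd_iff zero_less_abs_iff)
next
  case (neg P)
  then show ?case by simp
next
  case (conj P Q)
  from conj.IH(1) obtain D1 where D1: "D1 > 0" "\<forall>D>0. D1 dvd D \<longrightarrow> (\<exists>A. breakpoints i A \<and>
    (\<forall>e. (\<forall>(k, l)\<in>A. k * e i + l e \<noteq> 0) \<longrightarrow> P e = P (e(i := e i - D))))" by blast
  from conj.IH(2) obtain D2 where D2: "D2 > 0" "\<forall>D>0. D2 dvd D \<longrightarrow> (\<exists>A. breakpoints i A \<and>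
    (\<forall>e. (\<forall>(k, l)\<in>A. k * e i + l e \<noteq> 0) \<longrightarrow> Q e = Q (e(i := e i - D))))" by blast
  show ?case
  proof (intro exI[of _ "D1 * D2"] conjI allI impI)
    show "0 < D1 * D2" using D1 D2 by simp
    fix D :: int assume D: "0 < D" "D1 * D2 dvd D"
    from D have "D1 dvd D" "D2 dvd D" by (auto elim: dvd_mult_left dvd_mult_right)
    from D1(2)[rule_format, OF D(1) this(1)] obtain A where
      A: "breakpoints i A" "\<forall>e. (\<forall>(k, l)\<in>A. k * e i + l e \<noteq> 0) \<longrightarrow> P e = P (e(i := e i - D))"
      by blast
    from D2(2)[rule_format, OF D(1) \<open>D2 dvd D\<close>] obtain B where
      B: "breakpoints i B" "\<forall>e. (\<forall>(k, l)\<in>B. k * e i + l e \<noteq> 0) \<longrightarrow> Q e = Q (e(i := e i - D))"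
      by blast
    have "breakpoints i (A \<union> B)" using A(1) B(1) unfolding breakpoints_def by blast
    moreover have "(P e \<and> Q e) = (P (e(i := e i - D)) \<and> Q (e(i := e i - D)))"
      if "\<forall>(k, l)\<in>A \<union> B. k * e i + l e \<noteq> 0" for e
      using A(2)[THEN spec, of e] B(2)[THEN spec, of e] that by blast
    ultimately show "\<exists>A. breakpoints i A \<and> (\<forall>e. (\<forall>(k, l)\<in>A. k * e i + l e \<noteq> 0) \<longrightarrow>
        (P e \<and> Q e) = (P (e(i := e i - D)) \<and> Q (e(i := e i - D))))" by blast
  qed
qed

text \<open>\<open>Q\<close> is the limit of \<open>P\<close> as variable \<open>i\<close> tends to
  minus infinity: inequalities become constant in that variable, divisibilities are kept. Its
  periodicity covers shifts by multiples of either sign, because reduction modulo the period may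
  move a value upwards.\<close>

lemma quant_free_minus_infinity:
  assumes "quant_free P"
  shows "\<exists>Q D0. quant_free Q \<and> D0 > 0 \<and> (\<forall>D e. D0 dvd D \<longrightarrow> Q (e(i := e i - D)) = Q e) \<and>
    (\<forall>e. \<exists>z. \<forall>x<z. P (e(i := x)) = Q (e(i := x)))"
  using assms
proof (induction rule: quant_free.induct)
  case (le l)
  obtain k l' where l': "affine_form l'" "indep i l'" "\<And>e. l e = k * e i + l' e"
    using affine_form_split[OF le] by metis
  consider "k = 0" | "k > 0" | "k < 0" by linarith
  then show ?case
  proof cases
    case 1
    then show ?thesis
      using l' le by (intro exI[of _ "\<lambda>e. l e \<le> 0"] exI[of _ 1]) 
        (simp add: quant_free.le l'(3) indepD[OF l'(2)] del: fun_upd_apply)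
  next
    case 2
    \<comment> \<open>The bound \<open>- \<bar>l' e\<bar>\<close> suffices: for negative
      \<open>x\<close> and \<open>k \<ge> 1\<close> one has \<open>k * x \<le> x\<close>. The case
      of negative \<open>k\<close> is symmetric.\<close>
    have "l (e(i := x)) \<le> 0" if "x < - \<bar>l' e\<bar>" for e x
    proof -
      have "k * x \<le> 1 * x" using 2 that by (intro mult_right_mono_neg) auto
      then show ?thesis using that by (simp add: l'(3) indepD[OF l'(2)])
    qed
    then have "\<exists>z. \<forall>x<z. l (e(i := x)) \<le> 0" for e by blast
    then show ?thesis
      by (intro exI[of _ "\<lambda>e. True"] exI[of _ 1]) (simp add: quant_free_const del: fun_upd_apply)
  next
    case 3
    have "\<not> l (e(i := x)) \<le> 0" if "x < - \<bar>l' e\<bar>" for e x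
    proof -
      have "k * x \<ge> (-1) * x" using 3 that by (intro mult_right_mono_neg) auto
      then show ?thesis using that by (simp add: l'(3) indepD[OF l'(2)])
    qed
    then have "\<exists>z. \<forall>x<z. \<not> l (e(i := x)) \<le> 0" for e by blast
    then show ?thesis
      by (intro exI[of _ "\<lambda>e. False"] exI[of _ 1]) (simp add: quant_free_const del: fun_upd_apply)
  qed
next
  case (dvd l d)
  obtain k l' where l': "affine_form l'" "indep i l'" "\<And>e. l e = k * e i + l' e"
    using affine_form_split[OF dvd(1)] by metis
  have "d dvd l (e(i := e i - D)) \<longleftrightarrow> d dvd l e" if "d dvd D" for D e
  proof -
    have "l (e(i := e i - D)) = l e - k * D" by (simp add: l'(3) indepD[OF l'(2)] algebra_simps)
    moreover have "d dvd k * D" using that by simp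
    ultimately show ?thesis by (metis diff_add_cancel dvd_add_left_iff)
  qed
  with dvd show ?case
    by (intro exI[of _ "\<lambda>e. d dvd l e"] exI[of _ "\<bar>d\<bar>"])
      (simp add: quant_free.dvd del: fun_upd_apply)
next
  case (neg P)
  then obtain Q D0 where "quant_free Q" "D0 > 0" "\<forall>D e. D0 dvd D \<longrightarrow> Q (e(i := e i - D)) = Q e"
    "\<forall>e. \<exists>z. \<forall>x<z. P (e(i := x)) = Q (e(i := x))" by blast
  then show ?case
    by (intro exI[of _ "\<lambda>e. \<not> Q e"] exI[of _ D0]) (simp add: quant_free.neg del: fun_upd_apply)
next
  case (conj P P')
  from conj.IH(1) obtain Q D0 where
    Q: "quant_free Q" "D0 > 0" "\<forall>D e. D0 dvd D \<longrightarrow> Q (e(i := e i - D)) = Q e"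
      "\<And>e. \<exists>z. \<forall>x<z. P (e(i := x)) = Q (e(i := x))" by blast
  from conj.IH(2) obtain Q' D0' where
    Q': "quant_free Q'" "D0' > 0" "\<forall>D e. D0' dvd D \<longrightarrow> Q' (e(i := e i - D)) = Q' e"
      "\<And>e. \<exists>z. \<forall>x<z. P' (e(i := x)) = Q' (e(i := x))" by blast
  have "\<exists>z. \<forall>x<z. (P (e(i := x)) \<and> P' (e(i := x))) = (Q (e(i := x)) \<and> Q' (e(i := x)))" for e
  proof -
    obtain z where "\<forall>x<z. P (e(i := x)) = Q (e(i := x))" using Q(4) by blast
    moreover obtain z' where "\<forall>x<z'. P' (e(i := x)) = Q' (e(i := x))" using Q'(4) by blast
    ultimately show ?thesis by (intro exI[of _ "min z z'"]) (simp del: fun_upd_apply)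
  qed
  moreover have "(Q (e(i := e i - D)) \<and> Q' (e(i := e i - D))) = (Q e \<and> Q' e)"
    if "D0 * D0' dvd D" for D e
  proof -
    have "D0 dvd D" "D0' dvd D" using that by (auto elim: dvd_mult_left dvd_mult_right)
    then show ?thesis using Q(3) Q'(3) by metis
  qed
  moreover have "quant_free (\<lambda>e. Q e \<and> Q' e)" "0 < D0 * D0'"
    using Q(1,2) Q'(1,2) by (simp_all add: quant_free.conj)
  ultimately show ?case by blast
qed

text \<open>If no witness solves a breakpoint equation, any witness can be lowered by
  \<open>D\<close> again and again, until \<open>P\<close> agrees with the periodic
  \<open>Q\<close>; then a residue modulo \<open>D\<close> satisfies \<open>Q\<close>. Conversely, a
  residue satisfying \<open>Q\<close> can be lowered into the range where \<open>Q\<close> agrees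
  with \<open>P\<close>. What remains is a finite disjunction over breakpoints and residues.\<close>

lemma quant_free_ex:
  assumes P: "quant_free P"
  shows "quant_free (\<lambda>e. \<exists>x. P (e(i := x)))"
proof -
  obtain Q D0 where Q: "quant_free Q" "D0 > 0"
    "\<And>D e. D0 dvd D \<Longrightarrow> Q (e(i := e i - D)) = Q e"
    "\<And>e. \<exists>z. \<forall>x<z. P (e(i := x)) = Q (e(i := x))"
    using quant_free_minus_infinity[OF P, of i] by blast
  obtain D1 where D1: "D1 > 0" "\<forall>D>0. D1 dvd D \<longrightarrow> (\<exists>A. breakpoints i A \<and>
    (\<forall>e. (\<forall>(k, l)\<in>A. k * e i + l e \<noteq> 0) \<longrightarrow> P e = P (e(i := e i - D))))"
    using quant_free_breakpoints[OF P, of i] by blast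
  \<comment> \<open>One shift has to be both a period of \<open>Q\<close> and admissible for the
    breakpoints of \<open>P\<close>.\<close>
  define D where "D = D0 * D1"
  have D: "D > 0" "D0 dvd D" "D1 dvd D" using Q D1 by (auto simp: D_def)
  obtain A where A: "breakpoints i A"
    and *: "\<And>e. (\<forall>(k, l)\<in>A. k * e i + l e \<noteq> 0) \<Longrightarrow> P e = P (e(i := e i - D))"
    using D1 D by meson
  have finA: "finite A" using A by (simp add: breakpoints_def)
  have step: "P (e(i := x)) = P (e(i := x - D))" if "\<forall>(k, l)\<in>A. k * x + l e \<noteq> 0" for e x
  proof -
    have "\<forall>(k, l)\<in>A. k * (e(i := x)) i + l (e(i := x)) \<noteq> 0"
      using A that by (fastforce simp: breakpoints_def indep_def simp del: fun_upd_apply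
          simp add: fun_upd_same)
    from *[OF this] show ?thesis by (simp del: fun_upd_apply add: fun_upd_same)
  qed
  have period: "Q (e(i := x - int n * D)) = Q (e(i := x))" for e x n
    using Q(3)[of "int n * D" "e(i := x)"] dvd_mult[OF D(2)] by simp
  have low: "\<exists>n. x - int n * D < z" for x z
  proof -
    define b where "b = \<bar>x\<bar> + \<bar>z\<bar> + 1"
    have "b * 1 \<le> b * D" using D by (intro mult_left_mono) (auto simp: b_def)
    moreover have "x - b < z" by (simp add: b_def)
    ultimately have "x - b * D < z" by simp
    then have "x - int (nat b) * D < z" by (simp add: b_def)
    then show ?thesis ..
  qed
  have equiv: "(\<exists>x. P (e(i := x))) \<longleftrightarrow>
      (\<exists>a\<in>A. \<exists>x. fst a * x + snd a e = 0 \<and> P (e(i := x))) \<or> (\<exists>j\<in>{0..<D}. Q (e(i := j)))" for e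
  proof
    assume "\<exists>x. P (e(i := x))"
    then obtain x where x: "P (e(i := x))" ..
    obtain z where z: "\<forall>x<z. P (e(i := x)) = Q (e(i := x))" using Q(4) by blast
    show "(\<exists>a\<in>A. \<exists>x. fst a * x + snd a e = 0 \<and> P (e(i := x))) \<or> (\<exists>j\<in>{0..<D}. Q (e(i := j)))"
    proof (cases "\<exists>a\<in>A. \<exists>x. fst a * x + snd a e = 0 \<and> P (e(i := x))")
      case no: False
      have down: "P (e(i := x - int n * D))" for n
      proof (induction n)
        case 0
        then show ?case using x by (simp del: fun_upd_apply)
      next
        case (Suc n)
        have "\<forall>(k, l)\<in>A. k * (x - int n * D) + l e \<noteq> 0"
          using Suc no by (force simp del: fun_upd_apply)
        from step[OF this] have "P (e(i := x - int n * D - D))" using Suc by blast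
        then show ?case by (simp add: algebra_simps del: fun_upd_apply)
      qed
      obtain n where n: "x - int n * D < z" using low by blast
      then have "Q (e(i := x - int n * D))" using down z by blast
      then have "Q (e(i := x))" using period by blast
      moreover have "Q (e(i := x mod D)) = Q (e(i := x))"
        using Q(3)[of "D * (x div D)" "e(i := x)"] dvd_mult2[OF D(2)]
        by (simp only: minus_mult_div_eq_mod fun_upd_same fun_upd_upd)
      ultimately have "Q (e(i := x mod D))" by simp
      then have "\<exists>j\<in>{0..<D}. Q (e(i := j))" using D(1) by (intro bexI[of _ "x mod D"]) auto
      then show ?thesis ..
    qed blast
  next
    assume "(\<exists>a\<in>A. \<exists>x. fst a * x + snd a e = 0 \<and> P (e(i := x))) \<or> (\<exists>j\<in>{0..<D}. Q (e(i := j)))"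
    then show "\<exists>x. P (e(i := x))"
    proof
      assume "\<exists>j\<in>{0..<D}. Q (e(i := j))"
      then obtain j where j: "Q (e(i := j))" by blast
      obtain z where z: "\<forall>x<z. P (e(i := x)) = Q (e(i := x))" using Q(4) by blast
      obtain n where "j - int n * D < z" using low by blast
      with z j period show ?thesis by blast
    qed blast
  qed
  have "quant_free (\<lambda>e. \<exists>x. fst a * x + snd a e = 0 \<and> P (e(i := x)))" if "a \<in> A" for a
  proof -
    obtain k l where a: "a = (k, l)" by fastforce
    have kl: "k \<noteq> 0" "affine_form l" "indep i l" using A that by (auto simp: a breakpoints_def)
    obtain R where R: "quant_free R" "indep i R" "\<And>e. k * e i + l e = 0 \<Longrightarrow> P e = R e"
      using quant_free_solve[OF P kl] by blast
    have PR: "P (e(i := x)) = R e" if "k * x + l e = 0" for e x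
      using R(3)[of "e(i := x)"] that by (simp add: indepD[OF R(2)] indepD[OF kl(3)])
    \<comment> \<open>The equation has an integer solution iff \<open>k\<close> divides
      \<open>l e\<close>, and there \<open>P\<close> agrees with \<open>R\<close>, which no longer
      involves variable \<open>i\<close>.\<close>
    have "(\<exists>x. k * x + l e = 0 \<and> P (e(i := x))) \<longleftrightarrow> k dvd l e \<and> R e" for e
    proof
      assume "\<exists>x. k * x + l e = 0 \<and> P (e(i := x))"
      then obtain x where "k * x + l e = 0" "P (e(i := x))" by blast
      moreover from this have "l e = k * (- x)" by simp
      ultimately show "k dvd l e \<and> R e" using PR by (metis dvd_triv_left)
    next
      assume "k dvd l e \<and> R e"
      moreover from this obtain y where "l e = k * y" by blast
      ultimately show "\<exists>x. k * x + l e = 0 \<and> P (e(i := x))"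
        using PR by (intro exI[of _ "- y"]) auto
    qed
    then show ?thesis using R(1) kl by (auto simp: a intro: quant_free.intros)
  qed
  then show ?thesis
    unfolding equiv using Q(1) finA
    by (auto intro!: quant_free_disj quant_free_bex quant_free_subst)
qed

lemma quant_free_sat: "quant_free (\<lambda>e. sat e \<phi>)"
proof (induction \<phi>)
  have le: "quant_free (\<lambda>e. term_val e s \<le> term_val e t)" for s t
    using quant_free.le[OF affine_form_diff[OF affine_form_term_val affine_form_term_val], of s t]
    by simp
  {
    case (Le s t)
    show ?case using le by simp
  next
    case (Eq s t)
    show ?case using quant_free.conj[OF le[of s t] le[of t s]] by (simp add: eq_iff)
  next
    case (Forall i \<phi>)
    show ?case using neg[OF quant_free_ex[OF neg[OF Forall]], of i] by (simp del: fun_upd_apply)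
  }
qed (auto intro: quant_free.intros quant_free_disj quant_free_ex)

section \<open>Definable predicates on environments\<close>

text \<open>Free variables are unrestricted here, which makes Boolean closure immediate;
  \<open>definable_set_iff\<close> gets rid of the surplus ones.\<close>

definition definable_pred :: "((nat \<Rightarrow> int) \<Rightarrow> bool) \<Rightarrow> bool" where
  "definable_pred P \<longleftrightarrow> (\<exists>\<phi>. \<forall>e. sat e \<phi> = P e)"

lemma definable_pred_quant_free: "definable_pred P \<Longrightarrow> quant_free P"
proof -
  assume "definable_pred P"
  then obtain \<phi> where "P = (\<lambda>e. sat e \<phi>)" by (auto simp: definable_pred_def)
  then show ?thesis using quant_free_sat by simp
qed

lemma definable_pred_sat: "definable_pred (\<lambda>e. sat e \<phi>)"
  by (auto simp: definable_pred_def)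

lemma definable_pred_not: "definable_pred P \<Longrightarrow> definable_pred (\<lambda>e. \<not> P e)"
  unfolding definable_pred_def by (metis sat.simps(3))

lemma definable_pred_conj:
  "definable_pred P \<Longrightarrow> definable_pred Q \<Longrightarrow> definable_pred (\<lambda>e. P e \<and> Q e)"
  unfolding definable_pred_def by (metis sat.simps(4))

lemma definable_pred_disj:
  "definable_pred P \<Longrightarrow> definable_pred Q \<Longrightarrow> definable_pred (\<lambda>e. P e \<or> Q e)"
  unfolding definable_pred_def by (metis sat.simps(5))

lemma definable_pred_const: "definable_pred (\<lambda>e. b)"
proof -
  have "definable_pred (\<lambda>e. True)"
    using definable_pred_sat[of "Le (Var 0) (Var 0)"] by simp
  then show ?thesis using definable_pred_not by (cases b) fastforce+
qed

lemma definable_pred_bex: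
  assumes "finite A" "\<And>a. a \<in> A \<Longrightarrow> definable_pred (P a)"
  shows "definable_pred (\<lambda>e. \<exists>a\<in>A. P a e)"
  using assms by (induction A) (auto intro: definable_pred_const definable_pred_disj)

lemma definable_pred_ball:
  assumes "finite A" "\<And>a. a \<in> A \<Longrightarrow> definable_pred (P a)"
  shows "definable_pred (\<lambda>e. \<forall>a\<in>A. P a e)"
  using assms by (induction A) (auto intro: definable_pred_const definable_pred_conj)

lemma ex_block_formula:
  assumes "finite S"
  shows "\<exists>\<psi>. free_vars \<psi> = free_vars \<phi> - S \<and>
    (\<forall>e. sat e \<psi> \<longleftrightarrow> (\<exists>e'. (\<forall>i. i \<notin> S \<longrightarrow> e' i = e i) \<and> sat e' \<phi>))"
  using assms
proof induction
  case empty
  have "(\<forall>i. e' i = e i) \<longleftrightarrow> e' = e" for e e' :: "nat \<Rightarrow> int" by auto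
  then show ?case by (intro exI[of _ \<phi>]) simp
next
  case (insert a S)
  then obtain \<psi> where \<psi>: "free_vars \<psi> = free_vars \<phi> - S"
    "\<forall>e. sat e \<psi> \<longleftrightarrow> (\<exists>e'. (\<forall>i. i \<notin> S \<longrightarrow> e' i = e i) \<and> sat e' \<phi>)" by blast
  have "(\<exists>z. \<forall>i. i \<notin> S \<longrightarrow> e' i = (e(a := z)) i) \<longleftrightarrow> (\<forall>i. i \<notin> insert a S \<longrightarrow> e' i = e i)"
    for e e' :: "nat \<Rightarrow> int"
    using insert.hyps by (auto intro!: exI[of _ "e' a"])
  then have "sat e (Exists a \<psi>) \<longleftrightarrow> (\<exists>e'. (\<forall>i. i \<notin> insert a S \<longrightarrow> e' i = e i) \<and> sat e' \<phi>)" for e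
    using \<psi>(2) by (simp del: fun_upd_apply) blast
  then show ?case using \<psi>(1) by (intro exI[of _ "Exists a \<psi>"]) auto
qed

lemma definable_pred_ex_block:
  assumes "definable_pred P" "finite S"
  shows "definable_pred (\<lambda>e. \<exists>e'. (\<forall>i. i \<notin> S \<longrightarrow> e' i = e i) \<and> P e')"
proof -
  obtain \<phi> where "\<forall>e. sat e \<phi> = P e" using assms(1) by (auto simp: definable_pred_def)
  then show ?thesis
    using ex_block_formula[OF assms(2), of \<phi>] unfolding definable_pred_def by auto
qed

section \<open>Affine equations as formulas\<close>

lemma affine_form_indep: "affine_form l \<Longrightarrow> \<exists>N. \<forall>w\<ge>N. indep w l"
proof (induction rule: affine_form.induct)
  case (var i)
  show ?case by (intro exI[of _ "Suc i"]) (simp add: indep_def)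
next
  case (add l l')
  then obtain N N' where "\<forall>w\<ge>N. indep w l" "\<forall>w\<ge>N'. indep w l'" by blast
  then show ?case by (intro exI[of _ "max N N'"]) (simp add: indep_def)
qed (auto simp: indep_def)

text \<open>Terms have neither constants nor negative coefficients: the variables \<open>u\<close> and \<open>w\<close> stand for
  \<open>0\<close> and \<open>1\<close>, and an affine form is a difference of two terms.\<close>

lemma affine_form_terms:
  assumes "affine_form l"
  shows "\<exists>s t. \<forall>e. e u = 0 \<longrightarrow> e w = 1 \<longrightarrow> l e = term_val e s - term_val e t"
proof -
  have mult: "\<exists>t'. \<forall>e. e u = 0 \<longrightarrow> term_val e t' = int n * term_val e t" for n t
  proof (induction n)
    case 0
    show ?case by (intro exI[of _ "Var u"]) simp
  next
    case (Suc n)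
    then obtain t' where "\<forall>e. e u = 0 \<longrightarrow> term_val e t' = int n * term_val e t" by blast
    then show ?case by (intro exI[of _ "Add t t'"]) (simp add: algebra_simps)
  qed
  have scaled: "\<exists>s' t'. \<forall>e. e u = 0 \<longrightarrow>
      c * (term_val e s - term_val e t) = term_val e s' - term_val e t'" for c :: int and s t
  proof -
    obtain s' t' where *:
      "\<forall>e. e u = 0 \<longrightarrow> term_val e s' = int (nat \<bar>c\<bar>) * term_val e s"
      "\<forall>e. e u = 0 \<longrightarrow> term_val e t' = int (nat \<bar>c\<bar>) * term_val e t" using mult by meson
    \<comment> \<open>A negative factor is absorbed by exchanging the two terms of the
      difference.\<close>
    have eq: "c * (a - b) = (if c \<ge> 0 then int (nat \<bar>c\<bar>) * a - int (nat \<bar>c\<bar>) * b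
        else int (nat \<bar>c\<bar>) * b - int (nat \<bar>c\<bar>) * a)" for a b
      by (simp add: right_diff_distrib)
    have "c * (term_val e s - term_val e t)
        = term_val e (if c \<ge> 0 then s' else t') - term_val e (if c \<ge> 0 then t' else s')"
      if "e u = 0" for e
      using * that by (cases "c \<ge> 0") (simp_all only: eq if_True if_False simp_thms)
    then show ?thesis by blast
  qed
  from assms show ?thesis
  proof (induction rule: affine_form.induct)
    case (const c)
    obtain s t where "\<forall>e. e u = 0 \<longrightarrow>
        c * (term_val e (Var w) - term_val e (Var u)) = term_val e s - term_val e t"
      using scaled by blast
    then show ?case by (intro exI[of _ s] exI[of _ t]) auto
  next
    case (var i)
    show ?case by (intro exI[of _ "Var i"] exI[of _ "Var u"]) simp
  next
    case (add l l')
    then obtain s t s' t' where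
      "\<forall>e. e u = 0 \<longrightarrow> e w = 1 \<longrightarrow> l e = term_val e s - term_val e t"
      "\<forall>e. e u = 0 \<longrightarrow> e w = 1 \<longrightarrow> l' e = term_val e s' - term_val e t'" by blast
    then show ?case by (intro exI[of _ "Add s s'"] exI[of _ "Add t t'"]) simp
  next
    case (scale l c)
    then obtain s t where "\<forall>e. e u = 0 \<longrightarrow> e w = 1 \<longrightarrow> l e = term_val e s - term_val e t" by blast
    moreover obtain s' t' where "\<forall>e. e u = 0 \<longrightarrow>
        c * (term_val e s - term_val e t) = term_val e s' - term_val e t'"
      using scaled by blast
    ultimately show ?case by (intro exI[of _ s'] exI[of _ t']) simp
  qed
qed

text \<open>The constant 0 is the only solution of \<open>u + u = u\<close>, and 1 is the least
  positive integer. Variables \<open>u\<close> and \<open>w\<close> are bound to these values; they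
  are chosen beyond all variables on which the form depends, so rebinding them does not change
  it.\<close>

lemma definable_pred_affine_eq:
  assumes "affine_form l" "affine_form l'"
  shows "definable_pred (\<lambda>e. l e = l' e)"
proof -
  define h where "h = (\<lambda>e. l e - l' e)"
  have h: "affine_form h" unfolding h_def using assms by (rule affine_form_diff)
  obtain N where N: "\<And>w. w \<ge> N \<Longrightarrow> indep w h" using affine_form_indep[OF h] by blast
  define u w x where "u = N" and "w = Suc N" and "x = Suc (Suc N)"
  have uwx: "u \<noteq> w" "u \<noteq> x" "w \<noteq> x" by (simp_all add: u_def w_def x_def)
  obtain s t where st: "\<And>e. e u = 0 \<Longrightarrow> e w = 1 \<Longrightarrow> h e = term_val e s - term_val e t"
    using affine_form_terms[OF h] by metis
  have hu: "h (e(u := a, w := b)) = h e" for e a b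
    using N[of u] N[of w] by (simp add: u_def w_def indep_def)
  have one: "0 < b \<and> (\<forall>z. z \<le> 0 \<or> b \<le> z) \<longleftrightarrow> b = 1" for b :: int
    by (auto dest: spec[of _ 1])
  define \<phi> where "\<phi> = Exists u (Exists w (Conj (Eq (Add (Var u) (Var u)) (Var u))
    (Conj (Conj (Neg (Le (Var w) (Var u))) (Forall x (Disj (Le (Var x) (Var u)) (Le (Var w) (Var x)))))
      (Eq s t))))"
  have "sat e \<phi> \<longleftrightarrow> (\<exists>a b. a = 0 \<and> (0 < b \<and> (\<forall>z. z \<le> 0 \<or> b \<le> z)) \<and>
      term_val (e(u := a, w := b)) s = term_val (e(u := a, w := b)) t)" for e
    using uwx by (auto simp: \<phi>_def not_le)
  also have "\<dots> e \<longleftrightarrow> term_val (e(u := 0, w := 1)) s = term_val (e(u := 0, w := 1)) t" for e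
    unfolding one by simp
  also have "\<dots> e \<longleftrightarrow> l e = l' e" for e
  proof -
    have "term_val (e(u := 0, w := 1)) s - term_val (e(u := 0, w := 1)) t = l e - l' e"
      using st[of "e(u := 0, w := 1)"] uwx(1) hu[of e 0 1] by (simp add: h_def)
    then show ?thesis by (metis eq_iff_diff_eq_0)
  qed
  finally show ?thesis unfolding definable_pred_def by blast
qed

section \<open>Definable sets\<close>

definition int_vec :: "nat \<Rightarrow> (nat \<Rightarrow> int) \<Rightarrow> real vec" where
  "int_vec m e = vec m (\<lambda>i. of_int (e i))"

lemma dim_int_vec [simp]: "dim_vec (int_vec m e) = m"
  and int_vec_carrier [simp]: "int_vec m e \<in> carrier_vec m"
  and index_int_vec [simp]: "i < m \<Longrightarrow> int_vec m e $ i = of_int (e i)"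
  by (simp_all add: int_vec_def)

lemma int_vec_eq_iff: "int_vec m e = int_vec m e' \<longleftrightarrow> (\<forall>i<m. e i = e' i)"
  by (auto simp: vec_eq_iff)

lemma int_points_eq: "int_points m = range (int_vec m)"
proof
  show "int_points m \<subseteq> range (int_vec m)"
  proof
    fix v assume "v \<in> int_points m"
    then have "v = int_vec m (\<lambda>i. \<lfloor>v $ i\<rfloor>)" by (auto simp: int_points_def vec_eq_iff)
    then show "v \<in> range (int_vec m)" by blast
  qed
qed (auto simp: int_points_def)

text \<open>The representative with zero tail is the one to which
  \<open>affine_form_explicit\<close> applies.\<close>

lemma int_points_obtain:
  assumes "v \<in> int_points m"
  obtains e where "v = int_vec m e" "\<And>j. j \<ge> m \<Longrightarrow> e j = 0"
proof -
  obtain e where "v = int_vec m e" using assms by (auto simp: int_points_eq)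
  then show thesis
    using that[of "\<lambda>j. if j < m then e j else 0"] by (auto simp: int_vec_eq_iff)
qed

lemma int_vec_append: "int_vec (n + q) e = int_vec n e @\<^sub>v int_vec q (\<lambda>j. e (n + j))"
  by (auto simp: vec_eq_iff)

lemma int_points_append_iff:
  assumes "x \<in> carrier_vec n" "y \<in> carrier_vec q"
  shows "x @\<^sub>v y \<in> int_points (n + q) \<longleftrightarrow> x \<in> int_points n \<and> y \<in> int_points q"
proof
  assume "x @\<^sub>v y \<in> int_points (n + q)"
  then obtain e where "x @\<^sub>v y = int_vec n e @\<^sub>v int_vec q (\<lambda>j. e (n + j))"
    by (auto simp: int_points_eq int_vec_append)
  then show "x \<in> int_points n \<and> y \<in> int_points q"
    using append_vec_eq[OF assms(1) int_vec_carrier] by (auto simp: int_points_eq)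
next
  assume "x \<in> int_points n \<and> y \<in> int_points q"
  then show "x @\<^sub>v y \<in> int_points (n + q)" by (auto simp: int_points_def)
qed

lemma term_val_cong: "(\<And>i. i \<in> term_vars t \<Longrightarrow> e i = e' i) \<Longrightarrow> term_val e t = term_val e' t"
  by (induction t) auto

lemma sat_cong: "(\<And>i. i \<in> free_vars \<phi> \<Longrightarrow> e i = e' i) \<Longrightarrow> sat e \<phi> = sat e' \<phi>"
proof (induction \<phi> arbitrary: e e')
  case (Le s t)
  then show ?case using term_val_cong[of s e e'] term_val_cong[of t e e'] by simp
next
  case (Eq s t)
  then show ?case using term_val_cong[of s e e'] term_val_cong[of t e e'] by simp
next
  case (Neg \<phi>)
  show ?case using Neg.IH[of e e'] Neg.prems by simp
next
  case (Conj \<phi> \<psi>)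
  show ?case using Conj.IH[of e e'] Conj.prems by simp
next
  case (Disj \<phi> \<psi>)
  show ?case using Disj.IH[of e e'] Disj.prems by simp
next
  case (Exists i \<phi>)
  have "sat (e(i := z)) \<phi> = sat (e'(i := z)) \<phi>" for z
    by (rule Exists.IH) (use Exists.prems in auto)
  then show ?case by simp
next
  case (Forall i \<phi>)
  have "sat (e(i := z)) \<phi> = sat (e'(i := z)) \<phi>" for z
    by (rule Forall.IH) (use Forall.prems in auto)
  then show ?case by simp
qed

lemma finite_free_vars: "finite (free_vars \<phi>)"
proof -
  have "finite (term_vars t)" for t by (induction t) auto
  then show ?thesis by (induction \<phi>) auto
qed

text \<open>A formula for the predicate may mention variables from \<open>m\<close> on, but its
  truth depends only on the first \<open>m\<close> coordinates. Quantifying the others existentially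
  therefore does not change its meaning.\<close>

lemma definable_set_iff:
  "definable_set m X \<longleftrightarrow> X \<subseteq> int_points m \<and> definable_pred (\<lambda>e. int_vec m e \<in> X)"
proof
  assume "definable_set m X"
  then obtain \<phi> where \<phi>: "free_vars \<phi> \<subseteq> {..<m}" "X = {int_vec m e | e. sat e \<phi>}"
    by (auto simp: definable_set_def int_vec_def)
  have "sat e \<phi> = (int_vec m e \<in> X)" for e
  proof
    assume "int_vec m e \<in> X"
    then obtain e' where "int_vec m e = int_vec m e'" "sat e' \<phi>" using \<phi>(2) by auto
    then show "sat e \<phi>" using sat_cong[of \<phi> e e'] \<phi>(1) by (auto simp: int_vec_eq_iff)
  qed (use \<phi>(2) in blast)
  then show "X \<subseteq> int_points m \<and> definable_pred (\<lambda>e. int_vec m e \<in> X)"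
    unfolding definable_pred_def using \<phi>(2) int_points_eq by blast
next
  assume X: "X \<subseteq> int_points m \<and> definable_pred (\<lambda>e. int_vec m e \<in> X)"
  then obtain \<phi> where \<phi>: "\<And>e. sat e \<phi> = (int_vec m e \<in> X)" by (auto simp: definable_pred_def)
  obtain \<psi> where \<psi>: "free_vars \<psi> = free_vars \<phi> - (free_vars \<phi> - {..<m})"
    "\<And>e. sat e \<psi> \<longleftrightarrow> (\<exists>e'. (\<forall>i. i \<notin> free_vars \<phi> - {..<m} \<longrightarrow> e' i = e i) \<and> sat e' \<phi>)"
    using ex_block_formula[of "free_vars \<phi> - {..<m}" \<phi>] finite_free_vars by blast
  have "sat e \<psi> \<longleftrightarrow> int_vec m e \<in> X" for e
  proof
    assume "sat e \<psi>"
    then obtain e' where e': "\<forall>i. i \<notin> free_vars \<phi> - {..<m} \<longrightarrow> e' i = e i" "int_vec m e' \<in> X"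
      using \<psi>(2) \<phi> by blast
    then have "int_vec m e' = int_vec m e" by (simp add: int_vec_eq_iff)
    with e' show "int_vec m e \<in> X" by simp
  next
    assume "int_vec m e \<in> X"
    then show "sat e \<psi>" using \<psi>(2) \<phi> by blast
  qed
  then have "X = {int_vec m e | e. sat e \<psi>}" using X int_points_eq by auto
  then show "definable_set m X"
    using \<psi>(1) unfolding definable_set_def int_vec_def by blast
qed

lemma definable_set_Diff:
  assumes "definable_set m X" "definable_set m Y"
  shows "definable_set m (X - Y)"
  using assms unfolding definable_set_iff
  by (auto intro!: definable_pred_conj definable_pred_not)

lemma definable_set_Union:
  assumes "finite \<C>" "\<And>X. X \<in> \<C> \<Longrightarrow> definable_set m X"
  shows "definable_set m (\<Union>\<C>)"
  using assms unfolding definable_set_iff by (auto intro!: definable_pred_bex)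

text \<open>Each new member of the cover contributes only what earlier members miss; definability
  survives because it is closed under difference and finite union.\<close>

lemma definable_cover_refine:
  assumes "finite \<C>" "\<And>X. X \<in> \<C> \<Longrightarrow> definable_set m X"
  shows "\<exists>\<P>. finite \<P> \<and> partition_on (\<Union>\<C>) \<P> \<and> (\<forall>X\<in>\<P>. definable_set m X \<and> (\<exists>Y\<in>\<C>. X \<subseteq> Y))"
  using assms
proof induction
  case empty
  show ?case by (intro exI[of _ "{}"]) (simp add: partition_on_def)
next
  case (insert C \<C>)
  then obtain \<P> where \<P>: "finite \<P>" "partition_on (\<Union>\<C>) \<P>"
    "\<forall>X\<in>\<P>. definable_set m X \<and> (\<exists>Y\<in>\<C>. X \<subseteq> Y)" by blast
  \<comment> \<open>An empty difference is dropped, since the blocks of a partition are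
    nonempty.\<close>
  define \<P>' where "\<P>' = \<P> \<union> ({C - \<Union>\<C>} - {{}})"
  have "partition_on (\<Union>(insert C \<C>)) \<P>'"
  proof (rule partition_onI)
    show "\<Union>\<P>' = \<Union>(insert C \<C>)"
    proof -
      have "\<Union>({C - \<Union>\<C>} - {{}}) = C - \<Union>\<C>" by auto
      then show ?thesis using partition_onD1[OF \<P>(2)] by (simp add: \<P>'_def Un_commute)
    qed
    show "{} \<notin> \<P>'" using \<P>(2) by (auto simp: \<P>'_def partition_on_def)
    fix X Y assume "X \<in> \<P>'" "Y \<in> \<P>'" "X \<noteq> Y"
    moreover have "X \<subseteq> \<Union>\<C>" if "X \<in> \<P>" for X
      using \<P>(2) that by (auto simp: partition_on_def)
    moreover have "disjoint \<P>" using \<P>(2) by (simp add: partition_on_def)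
    ultimately show "disjnt X Y"
      by (auto simp: \<P>'_def disjnt_def dest: disjointD)
  qed
  moreover have "definable_set m X \<and> (\<exists>Y\<in>insert C \<C>. X \<subseteq> Y)" if X: "X \<in> \<P>'" for X
  proof -
    have "definable_set m (C - \<Union>\<C>)"
      using insert by (intro definable_set_Diff definable_set_Union) auto
    then show ?thesis using X \<P>(3) by (auto simp: \<P>'_def)
  qed
  moreover have "finite \<P>'" using \<P>(1) by (simp add: \<P>'_def)
  ultimately show ?case by blast
qed

section \<open>Definable functions\<close>

lemma common_denominator:
  assumes "finite R"
  shows "\<exists>k::int. k > 0 \<and> (\<forall>r\<in>R. \<exists>a. of_int k * r = (of_int a :: rat))"
  using assms
proof induction
  case empty
  show ?case by (intro exI[of _ 1]) simp
next
  case (insert r R)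
  then obtain k where k: "k > 0" "\<forall>r\<in>R. \<exists>a. of_int k * r = (of_int a :: rat)" by blast
  obtain p d where r: "r = of_int p / of_int d" and d: "d > 0"
    by (metis quotient_of_denom_pos quotient_of_div surj_pair)
  have "of_int (k * d) * r = of_int (k * p)" using d by (simp add: r)
  moreover have "\<exists>a. of_int (k * d) * r' = (of_int a :: rat)" if "r' \<in> R" for r'
  proof -
    obtain a where "of_int k * r' = of_int a" using k(2) \<open>r' \<in> R\<close> by blast
    then have "of_int (k * d) * r' = of_int (d * a)"
      by (metis mult.commute mult.left_commute of_int_mult)
    then show ?thesis ..
  qed
  ultimately have "\<forall>r'\<in>insert r R. \<exists>a. of_int (k * d) * r' = (of_int a :: rat)" by blast
  then show ?case using k(1) d by (intro exI[of _ "k * d"]) simp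
qed

text \<open>One row of \<open>y = M x + v\<close> after multiplication by a common denominator
  \<open>k\<close>. The integer coefficients make it expressible by a formula, while real arguments
  allow comparison with \<open>rat_linear\<close>.\<close>

definition row_eq :: "nat \<Rightarrow> int \<times> int \<times> (nat \<Rightarrow> int) \<Rightarrow> real vec \<Rightarrow> real \<Rightarrow> bool" where
  "row_eq n = (\<lambda>(k, c, a) x y. of_int k * y = of_int c + (\<Sum>j<n. of_int (a j) * x $ j))"

lemma row_eq_int_vec:
  "row_eq n (k, c, a) (int_vec n e) (of_int z) \<longleftrightarrow> k * z = c + (\<Sum>j<n. a j * e j)"
proof -
  have "row_eq n (k, c, a) (int_vec n e) (of_int z) \<longleftrightarrow>
      real_of_int (k * z) = real_of_int (c + (\<Sum>j<n. a j * e j))"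
    by (simp add: row_eq_def)
  then show ?thesis by (simp only: of_int_eq_iff)
qed

lemma definable_pred_row_eq: "definable_pred (\<lambda>e. row_eq n r (int_vec n e) (of_int (e i)))"
proof -
  obtain k c a where "r = (k, c, a)" by (cases r) auto
  then show ?thesis
    unfolding row_eq_int_vec
    by (auto simp: row_eq_int_vec intro!: definable_pred_affine_eq affine_form_sum affine_form.intros)
qed

lemma rat_row_eq:
  fixes M :: "rat mat" and v :: "rat vec"
  assumes "M \<in> carrier_mat q n" "v \<in> carrier_vec q" "i < q"
  shows "\<exists>r. \<forall>x\<in>carrier_vec n. \<forall>y.
    y = (map_mat of_rat M *\<^sub>v x + map_vec of_rat v) $ i \<longleftrightarrow> row_eq n r x y"
proof -
  have "finite (insert (v $ i) ((\<lambda>j. M $$ (i, j)) ` {..<n}))" by simp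
  from common_denominator[OF this] obtain k :: int where k: "k > 0"
    and *: "\<forall>r\<in>insert (v $ i) ((\<lambda>j. M $$ (i, j)) ` {..<n}). \<exists>a. of_int k * r = of_int a"
    by blast
  from * obtain c where c: "of_int k * v $ i = of_int c" by auto
  from * have "\<forall>j. \<exists>a. j < n \<longrightarrow> of_int k * M $$ (i, j) = of_int a" by auto
  then obtain a where a: "\<And>j. j < n \<Longrightarrow> of_int k * M $$ (i, j) = of_int (a j)" by metis
  have c': "real_of_int k * of_rat (v $ i) = of_int c"
    using arg_cong[OF c, of real_of_rat] by (simp add: of_rat_mult)
  have a': "real_of_int k * of_rat (M $$ (i, j)) = of_int (a j)" if "j < n" for j
    using arg_cong[OF a[OF that], of real_of_rat] by (simp add: of_rat_mult)
  have "y = (map_mat of_rat M *\<^sub>v x + map_vec of_rat v) $ i \<longleftrightarrow> row_eq n (k, c, a) x y"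
    if x: "x \<in> carrier_vec n" for x y
  proof -
    let ?v = "(map_mat of_rat M *\<^sub>v x + map_vec of_rat v) $ i"
    have "?v = (\<Sum>j<n. of_rat (M $$ (i, j)) * x $ j) + of_rat (v $ i)"
      using assms x by (simp add: scalar_prod_def lessThan_atLeast0)
    then have "of_int k * ?v
        = (\<Sum>j<n. of_int k * of_rat (M $$ (i, j)) * x $ j) + of_int k * of_rat (v $ i)"
      by (simp add: algebra_simps sum_distrib_left)
    also have "\<dots> = of_int c + (\<Sum>j<n. of_int (a j) * x $ j)"
      using a' c' by simp
    finally have "row_eq n (k, c, a) x y \<longleftrightarrow> of_int k * y = of_int k * ?v"
      by (simp add: row_eq_def)
    then show ?thesis using k by auto
  qed
  then show ?thesis by blast
qed

lemma row_eq_rat_linear: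
  assumes "dom f \<subseteq> carrier_vec n" "ran f \<subseteq> carrier_vec q"
    and rows: "\<And>i. i < q \<Longrightarrow> fst (r i) \<noteq> 0"
    and eq: "\<And>x y i. f x = Some y \<Longrightarrow> i < q \<Longrightarrow> row_eq n (r i) x (y $ i)"
  shows "rat_linear n q f"
proof -
  define k c a where "k = (\<lambda>i. fst (r i))" and "c = (\<lambda>i. fst (snd (r i)))"
    and "a = (\<lambda>i. snd (snd (r i)))"
  define M where "M = mat q n (\<lambda>(i, j). Fract (a i j) (k i))"
  define v where "v = vec q (\<lambda>i. Fract (c i) (k i))"
  have "f x = Some (map_mat of_rat M *\<^sub>v x + map_vec of_rat v)" if "x \<in> dom f" for x
  proof -
    obtain y where y: "f x = Some y" using \<open>x \<in> dom f\<close> by blast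
    then have xy: "x \<in> carrier_vec n" "y \<in> carrier_vec q"
      using assms(1,2) by (auto simp: ran_def)
    have "y = map_mat of_rat M *\<^sub>v x + map_vec of_rat v"
    proof (rule eq_vecI)
      fix i assume "i < dim_vec (map_mat of_rat M *\<^sub>v x + map_vec of_rat v)"
      then have i: "i < q" by (simp add: v_def)
      have "of_int (k i) * y $ i = of_int (c i) + (\<Sum>j<n. of_int (a i j) * x $ j)"
        using eq[OF y i] by (simp add: row_eq_def k_def c_def a_def case_prod_beta)
      then have "y $ i = (of_int (c i) + (\<Sum>j<n. of_int (a i j) * x $ j)) / of_int (k i)"
        using rows[OF i] by (simp add: k_def field_simps)
      also have "\<dots> = (\<Sum>j<n. of_int (a i j) / of_int (k i) * x $ j) + of_int (c i) / of_int (k i)"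
        by (simp add: add_divide_distrib sum_divide_distrib)
      also have "\<dots> = (map_mat of_rat M *\<^sub>v x + map_vec of_rat v) $ i"
        using i xy rows[OF i]
        by (simp add: M_def v_def k_def scalar_prod_def lessThan_atLeast0 of_rat_rat)
      finally show "y $ i = (map_mat of_rat M *\<^sub>v x + map_vec of_rat v) $ i" .
    qed (use xy in \<open>simp add: v_def\<close>)
    with y show ?thesis by simp
  qed
  moreover have "M \<in> carrier_mat q n" "v \<in> carrier_vec q" by (simp_all add: M_def v_def)
  ultimately show ?thesis unfolding rat_linear_def by blast
qed

section \<open>The two directions of the equivalence\<close>

context
  fixes f :: "real vec \<rightharpoonup> real vec" and n q :: nat
  assumes dom_f: "dom f \<subseteq> carrier_vec n" and ran_f: "ran f \<subseteq> carrier_vec q"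
begin

lemma carrier_f: "f x = Some y \<Longrightarrow> x \<in> carrier_vec n" "f x = Some y \<Longrightarrow> y \<in> carrier_vec q"
  using dom_f ran_f by (auto simp: ran_def)

lemma int_vec_graph_iff:
  "int_vec (n + q) e \<in> {x @\<^sub>v y | x y. (x, y) \<in> Map.graph f} \<longleftrightarrow>
    f (int_vec n e) = Some (int_vec q (\<lambda>j. e (n + j)))"
proof
  assume "int_vec (n + q) e \<in> {x @\<^sub>v y | x y. (x, y) \<in> Map.graph f}"
  then obtain x y where "int_vec n e @\<^sub>v int_vec q (\<lambda>j. e (n + j)) = x @\<^sub>v y" "f x = Some y"
    by (auto simp: int_vec_append in_graphD)
  then show "f (int_vec n e) = Some (int_vec q (\<lambda>j. e (n + j)))"
    using append_vec_eq[OF int_vec_carrier carrier_f(1)] by metis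
qed (auto simp: int_vec_append intro!: in_graphI)

text \<open>A concatenation is an integer point iff both of its parts are. This is where the
  integrality of the values enters.\<close>

lemma definable_fun_iff:
  "definable_fun n q f \<longleftrightarrow> dom f \<subseteq> int_points n \<and> ran f \<subseteq> int_points q \<and>
    definable_pred (\<lambda>e. f (int_vec n e) = Some (int_vec q (\<lambda>j. e (n + j))))"
proof -
  have "{x @\<^sub>v y | x y. (x, y) \<in> Map.graph f} \<subseteq> int_points (n + q) \<longleftrightarrow>
      (\<forall>x y. f x = Some y \<longrightarrow> x @\<^sub>v y \<in> int_points (n + q))"
    by (auto dest: in_graphD intro: in_graphI)
  also have "\<dots> \<longleftrightarrow> dom f \<subseteq> int_points n \<and> ran f \<subseteq> int_points q"
    using int_points_append_iff carrier_f by (fastforce simp: ran_def)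
  finally show ?thesis
    unfolding definable_fun_def definable_set_iff int_vec_graph_iff by simp
qed

text \<open>After projecting away the other outputs, \<open>P\<close> relates the argument to
  coordinate \<open>i\<close> of the value alone. At the true value \<open>P\<close> holds; at that
  value minus \<open>D\<close> it fails, because \<open>f\<close> is single-valued. So the true
  value solves a breakpoint equation.\<close>

lemma definable_fun_rows:
  assumes "definable_fun n q f" and i: "i < q"
  shows "\<exists>T. finite T \<and> (\<forall>r\<in>T. fst r \<noteq> 0) \<and> (\<forall>x y. f x = Some y \<longrightarrow> (\<exists>r\<in>T. row_eq n r x (y $ i)))"
proof -
  let ?G = "\<lambda>e. f (int_vec n e) = Some (int_vec q (\<lambda>j. e (n + j)))"
  have f: "dom f \<subseteq> int_points n" "ran f \<subseteq> int_points q" "definable_pred ?G"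
    using assms(1) definable_fun_iff by auto
  let ?S = "{n..<n + q} - {n + i}"
  define P where "P = (\<lambda>e. \<exists>e'. (\<forall>j. j \<notin> ?S \<longrightarrow> e' j = e j) \<and> ?G e')"
  have P_iff: "P e \<longleftrightarrow> (\<exists>y. f (int_vec n e) = Some y \<and> y $ i = of_int (e (n + i)))" for e
  proof
    assume "P e"
    then obtain e' where e': "\<forall>j. j \<notin> ?S \<longrightarrow> e' j = e j" "?G e'" by (auto simp: P_def)
    then have "int_vec n e' = int_vec n e" by (simp add: int_vec_eq_iff)
    with e' i show "\<exists>y. f (int_vec n e) = Some y \<and> y $ i = of_int (e (n + i))" by auto
  next
    assume "\<exists>y. f (int_vec n e) = Some y \<and> y $ i = of_int (e (n + i))"
    then obtain y where y: "f (int_vec n e) = Some y" "y $ i = of_int (e (n + i))" by blast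
    then have "y \<in> int_points q" using f(2) by (auto simp: ran_def)
    then obtain b where b: "y = int_vec q b" using int_points_obtain by blast
    define e' where "e' j = (if n \<le> j \<and> j < n + q then b (j - n) else e j)" for j
    have "int_vec n e' = int_vec n e" by (simp add: e'_def int_vec_eq_iff)
    moreover have "int_vec q (\<lambda>j. e' (n + j)) = y" by (simp add: b e'_def int_vec_eq_iff)
    moreover have "e' j = e j" if "j \<notin> ?S" for j
      using that y(2) i b by (auto simp: e'_def)
    ultimately show "P e" using y(1) unfolding P_def by (intro exI[of _ e']) simp
  qed
  have "quant_free P"
    unfolding P_def using f(3) by (intro definable_pred_quant_free definable_pred_ex_block) auto
  from quant_free_breakpoints[OF this, of "n + i"] obtain D A where D: "D > 0"
    and A: "breakpoints (n + i) A"
    and *: "\<And>e. (\<forall>(k, l)\<in>A. k * e (n + i) + l e \<noteq> 0) \<Longrightarrow> P e = P (e(n + i := e (n + i) - D))"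
    by (meson dvd_refl)
  \<comment> \<open>The pair is chosen from the form alone, before any environment, so finitely many
    forms yield finitely many rows.\<close>
  have "\<forall>l. \<exists>ca. affine_form l \<longrightarrow>
      (\<forall>e. (\<forall>j\<ge>n. e j = 0) \<longrightarrow> l e = fst ca + (\<Sum>j<n. snd ca j * e j))"
    using affine_form_explicit by simp
  then obtain ca where ca: "\<And>l e. affine_form l \<Longrightarrow> (\<And>j. j \<ge> n \<Longrightarrow> e j = 0) \<Longrightarrow>
      l e = fst (ca l) + (\<Sum>j<n. snd (ca l) j * e j)"
    by metis
  \<comment> \<open>The equation \<open>k * z + l = 0\<close> is rewritten as
    \<open>- k * z = l\<close> to match \<open>row_eq\<close>.\<close>
  define T where "T = (\<lambda>(k, l). (- k, ca l)) ` A"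
  have "\<exists>r\<in>T. row_eq n r x (y $ i)" if xy: "f x = Some y" for x y
  proof -
    have "x \<in> int_points n" "y \<in> int_points q" using f(1,2) xy by (auto simp: ran_def)
    \<comment> \<open>All outputs other than coordinate \<open>i\<close> can be left at 0, since
      \<open>P\<close> ignores them.\<close>
    then obtain e b where e: "x = int_vec n e" "\<And>j. j \<ge> n \<Longrightarrow> e j = 0" and b: "y = int_vec q b"
      using int_points_obtain by metis
    define e' where "e' = e(n + i := b i)"
    have upd: "int_vec n (e(n + i := z)) = x" for z by (simp add: e(1) int_vec_eq_iff)
    have "P (e(n + i := b i))" "\<not> P (e(n + i := b i - D))"
      using xy i D unfolding P_iff upd by (auto simp: b)
    then have "P e'" "\<not> P (e'(n + i := e' (n + i) - D))" by (simp_all add: e'_def)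
    with * obtain k l where kl: "(k, l) \<in> A" "k * e' (n + i) + l e' = 0" by blast
    from A kl(1) have l: "affine_form l" "indep (n + i) l" by (auto simp: breakpoints_def)
    have "- k * b i = fst (ca l) + (\<Sum>j<n. snd (ca l) j * e j)"
      using kl(2) ca[OF l(1) e(2)] by (simp add: e'_def indepD[OF l(2)])
    then have "row_eq n (- k, ca l) x (y $ i)"
      using row_eq_int_vec[of n "- k" "fst (ca l)" "snd (ca l)" e "b i"] i by (simp add: e(1) b)
    moreover have "(- k, ca l) \<in> T" using kl(1) by (force simp: T_def)
    ultimately show ?thesis by blast
  qed
  moreover have "finite T" "\<forall>r\<in>T. fst r \<noteq> 0"
    using A by (auto simp: T_def breakpoints_def)
  ultimately show ?thesis by blast
qed

text \<open>Selecting one row for every output coordinate determines a linear map, and finitely many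
  selections cover the domain. Each piece is definable by projecting the outputs away from the graph
  intersected with the selected equations.\<close>

lemma definable_imp_piecewise_linear:
  assumes "definable_fun n q f"
  shows "piecewise_linear n q f"
proof -
  let ?G = "\<lambda>e. f (int_vec n e) = Some (int_vec q (\<lambda>j. e (n + j)))"
  have f: "dom f \<subseteq> int_points n" "ran f \<subseteq> int_points q" "definable_pred ?G"
    using assms definable_fun_iff by auto
  obtain T where T: "\<And>i. i < q \<Longrightarrow> finite (T i)" "\<And>i r. i < q \<Longrightarrow> r \<in> T i \<Longrightarrow> fst r \<noteq> 0"
    "\<And>i x y. i < q \<Longrightarrow> f x = Some y \<Longrightarrow> \<exists>r\<in>T i. row_eq n r x (y $ i)"
    using definable_fun_rows[OF assms] by metis
  define piece where "piece s = {x. \<exists>y. f x = Some y \<and> (\<forall>i<q. row_eq n (s i) x (y $ i))}" for s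
  \<comment> \<open>Extensional selections keep the family finite, hence the use of
    \<open>restrict\<close> when a piece is found for a given argument.\<close>
  define \<C> where "\<C> = piece ` PiE {..<q} T"
  have "finite \<C>" unfolding \<C>_def using T(1) by (intro finite_imageI finite_PiE) auto
  have "definable_set n (piece s)" for s
  proof -
    let ?Q = "\<lambda>e. ?G e \<and> (\<forall>i\<in>{..<q}. row_eq n (s i) (int_vec n e) (of_int (e (n + i))))"
    have "int_vec n e \<in> piece s \<longleftrightarrow> (\<exists>e'. (\<forall>j. j \<notin> {n..<n + q} \<longrightarrow> e' j = e j) \<and> ?Q e')" for e
    proof
      assume "int_vec n e \<in> piece s"
      then obtain y where y: "f (int_vec n e) = Some y"
        "\<forall>i<q. row_eq n (s i) (int_vec n e) (y $ i)" by (auto simp: piece_def)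
      then have "y \<in> int_points q" using f(2) by (auto simp: ran_def)
      then obtain b where b: "y = int_vec q b" using int_points_obtain by blast
      define e' where "e' j = (if n \<le> j \<and> j < n + q then b (j - n) else e j)" for j
      have "int_vec n e' = int_vec n e" by (simp add: e'_def int_vec_eq_iff)
      moreover have "int_vec q (\<lambda>j. e' (n + j)) = y" by (simp add: b e'_def int_vec_eq_iff)
      moreover have "y $ i = of_int (e' (n + i))" if "i < q" for i using that by (simp add: b e'_def)
      ultimately show "\<exists>e'. (\<forall>j. j \<notin> {n..<n + q} \<longrightarrow> e' j = e j) \<and> ?Q e'"
        using y by (intro exI[of _ e']) (auto simp: e'_def)
    next
      assume "\<exists>e'. (\<forall>j. j \<notin> {n..<n + q} \<longrightarrow> e' j = e j) \<and> ?Q e'"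
      then obtain e' where e': "\<forall>j. j \<notin> {n..<n + q} \<longrightarrow> e' j = e j" "?Q e'" by blast
      then have "int_vec n e' = int_vec n e" by (simp add: int_vec_eq_iff)
      with e' show "int_vec n e \<in> piece s" by (auto simp: piece_def)
    qed
    moreover have "definable_pred (\<lambda>e. \<exists>e'. (\<forall>j. j \<notin> {n..<n + q} \<longrightarrow> e' j = e j) \<and> ?Q e')"
      using f(3)
      by (intro definable_pred_ex_block definable_pred_conj definable_pred_ball definable_pred_row_eq)
        auto
    moreover have "piece s \<subseteq> int_points n" using f(1) by (auto simp: piece_def)
    ultimately show ?thesis unfolding definable_set_iff by simp
  qed
  then have "\<And>X. X \<in> \<C> \<Longrightarrow> definable_set n X" by (auto simp: \<C>_def)
  from definable_cover_refine[OF \<open>finite \<C>\<close> this]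
  obtain \<P> where \<P>: "finite \<P>" "partition_on (\<Union>\<C>) \<P>"
    "\<forall>X\<in>\<P>. definable_set n X \<and> (\<exists>Y\<in>\<C>. X \<subseteq> Y)" by blast
  have "\<Union>\<C> = dom f"
  proof
    show "\<Union>\<C> \<subseteq> dom f" by (auto simp: \<C>_def piece_def)
    show "dom f \<subseteq> \<Union>\<C>"
    proof
      fix x assume "x \<in> dom f"
      then obtain y where y: "f x = Some y" by blast
      have "\<forall>i. \<exists>r. i < q \<longrightarrow> r \<in> T i \<and> row_eq n r x (y $ i)" using T(3)[OF _ y] by blast
      then obtain s where s: "\<And>i. i < q \<Longrightarrow> s i \<in> T i \<and> row_eq n (s i) x (y $ i)" by metis
      then have "restrict s {..<q} \<in> PiE {..<q} T" by auto
      moreover have "x \<in> piece (restrict s {..<q})" using s y by (auto simp: piece_def)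
      ultimately show "x \<in> \<Union>\<C>" unfolding \<C>_def by blast
    qed
  qed
  moreover have "rat_linear n q (f |` X)" if X: "X \<in> \<P>" for X
  proof -
    obtain s where s: "s \<in> PiE {..<q} T" "X \<subseteq> piece s"
      using bspec[OF \<P>(3) X] by (auto simp: \<C>_def)
    show ?thesis
    proof (rule row_eq_rat_linear)
      show "dom (f |` X) \<subseteq> carrier_vec n" using dom_f by auto
      show "ran (f |` X) \<subseteq> carrier_vec q" using ran_f by (auto simp: ran_def restrict_map_def)
      show "fst (s i) \<noteq> 0" if "i < q" for i using T(2)[OF that PiE_mem[OF s(1)]] that by simp
      fix x y i assume xy: "(f |` X) x = Some y" and "i < q"
      then have "x \<in> piece s" "f x = Some y" using s(2) by (auto simp: restrict_map_def split: if_splits)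
      then show "row_eq n (s i) x (y $ i)" using \<open>i < q\<close> by (auto simp: piece_def)
    qed
  qed
  ultimately show ?thesis unfolding piecewise_linear_def using \<P> by auto
qed

text \<open>Over a block the row equations are necessary and sufficient for \<open>y\<close> to be
  the value, so the graph is a finite disjunction over the blocks of conjunctions of affine
  equations. Such a formula describes the integer points of the graph only; integrality of the
  values ensures that these are all of its points.\<close>

lemma piecewise_linear_imp_definable:
  assumes "piecewise_linear n q f" and ran: "ran f \<subseteq> int_points q"
  shows "definable_fun n q f"
proof -
  obtain \<P> where \<P>: "finite \<P>" "partition_on (dom f) \<P>" "\<And>X. X \<in> \<P> \<Longrightarrow> definable_set n X"
    "\<And>X. X \<in> \<P> \<Longrightarrow> rat_linear n q (f |` X)"
    using assms(1) unfolding piecewise_linear_def by blast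
  have dom: "dom f = \<Union>\<P>" using \<P>(2) by (simp add: partition_on_def)
  have "\<exists>r. \<forall>x\<in>X. \<forall>y\<in>carrier_vec q. f x = Some y \<longleftrightarrow> (\<forall>i<q. row_eq n (r i) x (y $ i))"
    if X: "X \<in> \<P>" for X
  proof -
    obtain M v where Mv: "M \<in> carrier_mat q n" "v \<in> carrier_vec q"
      and lin: "\<And>x. x \<in> dom (f |` X) \<Longrightarrow>
        (f |` X) x = Some (map_mat of_rat M *\<^sub>v x + map_vec of_rat v)"
      using \<P>(4)[OF X] unfolding rat_linear_def by blast
    obtain r where r: "\<And>i x y. i < q \<Longrightarrow> x \<in> carrier_vec n \<Longrightarrow>
        y = (map_mat of_rat M *\<^sub>v x + map_vec of_rat v) $ i \<longleftrightarrow> row_eq n (r i) x y"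
      using rat_row_eq[OF Mv] by metis
    have "f x = Some y \<longleftrightarrow> (\<forall>i<q. row_eq n (r i) x (y $ i))"
      if x: "x \<in> X" and y: "y \<in> carrier_vec q" for x y
    proof -
      have "x \<in> dom f" using dom X x by blast
      then have "x \<in> carrier_vec n" "f x = Some (map_mat of_rat M *\<^sub>v x + map_vec of_rat v)"
        using dom_f lin[of x] x by auto
      moreover have "y = map_mat of_rat M *\<^sub>v x + map_vec of_rat v \<longleftrightarrow>
          (\<forall>i<q. y $ i = (map_mat of_rat M *\<^sub>v x + map_vec of_rat v) $ i)"
        using y Mv by (auto simp: vec_eq_iff)
      ultimately show ?thesis using r by auto
    qed
    then show ?thesis by blast
  qed
  then obtain r where r: "\<And>X x y. X \<in> \<P> \<Longrightarrow> x \<in> X \<Longrightarrow> y \<in> carrier_vec q \<Longrightarrow>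
      f x = Some y \<longleftrightarrow> (\<forall>i<q. row_eq n (r X i) x (y $ i))"
    by metis
  have "f (int_vec n e) = Some (int_vec q (\<lambda>j. e (n + j))) \<longleftrightarrow>
      (\<exists>X\<in>\<P>. int_vec n e \<in> X \<and> (\<forall>i\<in>{..<q}. row_eq n (r X i) (int_vec n e) (of_int (e (n + i)))))"
    for e
  proof -
    have "f (int_vec n e) = Some (int_vec q (\<lambda>j. e (n + j))) \<longleftrightarrow>
        (\<exists>X\<in>\<P>. int_vec n e \<in> X \<and> f (int_vec n e) = Some (int_vec q (\<lambda>j. e (n + j))))"
      using dom by blast
    then show ?thesis using r[of _ "int_vec n e" "int_vec q (\<lambda>j. e (n + j))"] by auto
  qed
  moreover have "definable_pred (\<lambda>e. \<exists>X\<in>\<P>. int_vec n e \<in> X \<and>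
      (\<forall>i\<in>{..<q}. row_eq n (r X i) (int_vec n e) (of_int (e (n + i)))))"
    using \<P>(1,3) unfolding definable_set_iff
    by (intro definable_pred_bex definable_pred_conj definable_pred_ball definable_pred_row_eq) auto
  moreover have "dom f \<subseteq> int_points n"
    using dom \<P>(3) unfolding definable_set_iff by blast
  ultimately show ?thesis unfolding definable_fun_iff using ran by simp
qed

end

theorem theorem4p2:
  fixes f :: "real vec \<rightharpoonup> real vec" and n q :: nat
  assumes "dom f \<subseteq> carrier_vec n" and "ran f \<subseteq> carrier_vec q"
  shows "definable_fun n q f \<longleftrightarrow> piecewise_linear n q f \<and> ran f \<subseteq> int_points q"
  using definable_imp_piecewise_linear[OF assms] piecewise_linear_imp_definable[OF assms]
    definable_fun_iff[OF assms] by blast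

end
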